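(* Let $(\mathbf u^a,\theta^a,\mathbf u^o,\theta^o)$ be a sufficiently smooth solution of the deterministic atmosphere-ocean model, so that in particular $$\frac{\partial \mathbf u^a}{\partial t}+(\mathbf u^a\cdot\nabla)\mathbf u^a+\frac1{Ro^a}\mathbf u^{a\perp}+\frac1{Ro^a}\nabla\theta^a=\frac1{Re^a}\Delta\mathbf u^a .$$ Then for every closed material loop $c(u^a)$ moving with the flow of the atmospheric velocity $\mathbf u^a$, $$\frac{d}{dt}\oint_{c(u^a)}\Big(\mathbf u^a+\frac1{Ro^a}\mathbf R(\mathbf x)\Big)\cdot d\mathbf x=\frac1{Re^a}\oint_{c(u^a)}\Delta\mathbf u^a\cdot d\mathbf x .$$
   Context: The setting is a two-dimensional domain with coordinates $\mathbf x$. $\mathbf u^a(\mathbf x,t)\in\mathbb R^2$ is the atmospheric velocity, $\theta^a(\mathbf x,t)\in\mathbb R$ the atmospheric temperature; $\mathbf u^o$ and $\theta^o$ are the ocean velocity and temperature. $Ro^a,Re^a,Pe^a>0$ and $\gamma<0$ are constants. In the full model $\theta^a$ satisfies $\partial_t\theta^a+(\mathbf u^a\cdot\nabla)\theta^a=\gamma(\theta^a-\theta^o)+\frac1{Pe^a}\Delta\theta^a$. $\mathbf R(\mathbf x)$ is a given smooth time-independent planar vector field on the domain with $\mathrm{curl}\,\mathbf R=2\Omega(\mathbf x)\hat{\mathbf z}$ (the Coriolis parameter in nondimensional units), where $\hat{\mathbf z}$ is the unit vector normal to the plane. The Coriolis term is $\mathbf u^{\perp}:=-\mathbf u\times\mathrm{curl}\,\mathbf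 R=2\Omega(\mathbf x)\,\hat{\mathbf z}\times\mathbf u$. A closed material loop $c(u^a)$ is the image $c_t=g_t(c_0)$ of a fixed smooth closed loop $c_0$ under the flow $g_t$ of the time-dependent vector field $\mathbf u^a$. *)

theory Defs
  imports "HOL-Analysis.Analysis"
begin

text \<open>Derivatives are taken within \<open>S\<close>. The definition is meant for sets on which such a
  derivative is unique, here open sets, \<open>{0..1}\<close>, and \<open>{0..T} \<times> D\<close> with \<open>T > 0\<close> and \<open>D\<close> open;
  on these it is the usual class of \<open>k\<close> times continuously differentiable functions, with
  one-sided derivatives at the endpoints.\<close>

primrec Ck_on :: "nat \<Rightarrow> 'a::euclidean_space set \<Rightarrow> ('a \<Rightarrow> 'b::real_normed_vector) \<Rightarrow> bool" where
  "Ck_on 0 S f \<longleftrightarrow> continuous_on S f"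
| "Ck_on (Suc k) S f \<longleftrightarrow> f differentiable_on S \<and>
     (\<forall>i\<in>Basis. Ck_on k S (\<lambda>x. frechet_derivative f (at x within S) i))"

definition smooth_on :: "'a::euclidean_space set \<Rightarrow> ('a \<Rightarrow> 'b::real_normed_vector) \<Rightarrow> bool" where
  "smooth_on S f \<longleftrightarrow> (\<forall>k. Ck_on k S f)"

definition partial :: "'a::euclidean_space \<Rightarrow> ('a \<Rightarrow> 'b::real_normed_vector) \<Rightarrow> 'a \<Rightarrow> 'b" where
  "partial i f x = frechet_derivative f (at x) i"

definition grad :: "('a::euclidean_space \<Rightarrow> real) \<Rightarrow> 'a \<Rightarrow> 'a" where
  "grad f x = (\<Sum>i\<in>Basis. partial i f x *\<^sub>R i)"

definition laplacian :: "('a::euclidean_space \<Rightarrow> 'b::real_normed_vector) \<Rightarrow> 'a \<Rightarrow> 'b" where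
  "laplacian f x = (\<Sum>i\<in>Basis. partial i (partial i f) x)"

text \<open>\<open>advect v f x\<close> is \<open>(v \<cdot> \<nabla>) f\<close> at the point \<open>x\<close>, with \<open>v\<close> the velocity vector at \<open>x\<close>.\<close>

definition advect :: "'a::euclidean_space \<Rightarrow> ('a \<Rightarrow> 'b::real_normed_vector) \<Rightarrow> 'a \<Rightarrow> 'b" where
  "advect v f x = (\<Sum>i\<in>Basis. (v \<bullet> i) *\<^sub>R partial i f x)"

text \<open>The plane is identified with the plane spanned by the first two axes of \<open>real^3\<close>, and the
  normal \<open>zhat\<close> with the third axis.\<close>

definition zhat :: "real^3" where
  "zhat = axis 3 1"

definition embed3 :: "real^2 \<Rightarrow> real^3" where
  "embed3 v = vector [v $ 1, v $ 2, 0]"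

definition planar_part :: "real^3 \<Rightarrow> real^2" where
  "planar_part w = vector [w $ 1, w $ 2]"

definition curl :: "(real^2 \<Rightarrow> real^2) \<Rightarrow> real^2 \<Rightarrow> real^3" where
  "curl F x = (partial (axis 1 1) (\<lambda>y. F y $ 2) x - partial (axis 2 1) (\<lambda>y. F y $ 1) x) *\<^sub>R zhat"

text \<open>The Coriolis term \<open>- v \<times> curl R\<close> at \<open>x\<close>.\<close>

definition coriolis :: "(real^2 \<Rightarrow> real^2) \<Rightarrow> real^2 \<Rightarrow> real^2 \<Rightarrow> real^2" where
  "coriolis R x v = planar_part (- cross3 (embed3 v) (curl R x))"

lemma coriolis_eq_zhat_cross:
  assumes "curl R x = (2 * \<Omega> x) *\<^sub>R zhat"
  shows "coriolis R x v = planar_part ((2 * \<Omega> x) *\<^sub>R cross3 zhat (embed3 v))"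
    and "coriolis R x v = (2 * \<Omega> x) *\<^sub>R vector [- v $ 2, v $ 1]"
  by (simp_all add: coriolis_def assms zhat_def embed3_def planar_part_def cross3_def
      vec_eq_iff forall_2 forall_3 axis_def vector_2 vector_3)

text \<open>The atmospheric equations on \<open>[0,T] \<times> D\<close>. The ocean enters them only through its
  temperature \<open>\<theta>o\<close>.\<close>

definition atmosphere_momentum ::
  "real \<Rightarrow> (real^2) set \<Rightarrow> real \<Rightarrow> real \<Rightarrow> (real^2 \<Rightarrow> real^2) \<Rightarrow>
   (real \<Rightarrow> real^2 \<Rightarrow> real^2) \<Rightarrow> (real \<Rightarrow> real^2 \<Rightarrow> real) \<Rightarrow> bool" where
  "atmosphere_momentum T D Roa Rea R ua \<theta>a \<longleftrightarrow> (\<forall>t\<in>{0..T}. \<forall>x\<in>D.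
     vector_derivative (\<lambda>s. ua s x) (at t within {0..T}) + advect (ua t x) (ua t) x
       + (1 / Roa) *\<^sub>R coriolis R x (ua t x) + (1 / Roa) *\<^sub>R grad (\<theta>a t) x
     = (1 / Rea) *\<^sub>R laplacian (ua t) x)"

definition atmosphere_temperature ::
  "real \<Rightarrow> (real^2) set \<Rightarrow> real \<Rightarrow> real \<Rightarrow>
   (real \<Rightarrow> real^2 \<Rightarrow> real^2) \<Rightarrow> (real \<Rightarrow> real^2 \<Rightarrow> real) \<Rightarrow> (real \<Rightarrow> real^2 \<Rightarrow> real) \<Rightarrow> bool" where
  "atmosphere_temperature T D Pea \<gamma> ua \<theta>a \<theta>o \<longleftrightarrow> (\<forall>t\<in>{0..T}. \<forall>x\<in>D.
     vector_derivative (\<lambda>s. \<theta>a s x) (at t within {0..T}) + advect (ua t x) (\<theta>a t) x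
     = \<gamma> * (\<theta>a t x - \<theta>o t x) + (1 / Pea) * laplacian (\<theta>a t) x)"

text \<open>\<open>g\<close> is the flow of \<open>u\<close> on the set \<open>A\<close> of particles: every particle starting in \<open>A\<close> stays
  in \<open>D\<close> and moves with velocity \<open>u\<close> during \<open>[0,T]\<close>. A flow of all of \<open>D\<close> is the case \<open>A = D\<close>.\<close>

definition flow_on ::
  "real \<Rightarrow> 'a::real_normed_vector set \<Rightarrow> (real \<Rightarrow> 'a \<Rightarrow> 'a) \<Rightarrow> 'a set \<Rightarrow> (real \<Rightarrow> 'a \<Rightarrow> 'a) \<Rightarrow> bool" where
  "flow_on T D u A g \<longleftrightarrow> (\<forall>x\<in>A. g 0 x = x \<and> (\<forall>t\<in>{0..T}. g t x \<in> D \<and>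
     ((\<lambda>s. g s x) has_vector_derivative u t (g t x)) (at t within {0..T})))"

definition line_integral :: "('a::real_inner \<Rightarrow> 'a) \<Rightarrow> (real \<Rightarrow> 'a) \<Rightarrow> real" where
  "line_integral F c =
     integral {0..1} (\<lambda>s. F (c s) \<bullet> vector_derivative c (at s within {0..1}))"

end

theory Submission
  imports Defs
begin

text \<open>This is Kelvin's circulation theorem with a Coriolis potential. Parametrize the material loop
  at time \<open>t\<close> by \<open>X t s = g t (c s)\<close> and let \<open>W = \<partial>\<^sub>s X\<close> be its tangent. As the loop moves with the
  velocity \<open>u\<close>, the tangent is stretched according to \<open>\<partial>\<^sub>t W = Du W\<close>, so the circulation of
  \<open>u + R / Ro\<close> changes at the rate
  \<open>\<integral> (\<partial>\<^sub>t u + Du u + DR u / Ro) \<bullet> W + (u + R / Ro) \<bullet> Du W ds\<close> (lemma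
  \<open>circulation_has_derivative\<close>). The momentum equation replaces \<open>\<partial>\<^sub>t u + Du u\<close> by the viscous term
  minus \<open>1 / Ro\<close> times the temperature gradient and the Coriolis term. The latter, paired with
  \<open>W\<close>, is \<open>DR u \<bullet> W - DR W \<bullet> u\<close> (lemma \<open>coriolis_inner\<close>). What is left besides the viscous term is
  \<open>\<partial>\<^sub>s (u \<bullet> u / 2 + (R \<bullet> u - \<theta>) / Ro)\<close> along the loop, whose integral is zero because the loop is
  closed.

  The analytic content is that \<open>W\<close> exists, is jointly continuous in \<open>(t, s)\<close> and satisfies the
  stretching equation (lemma \<open>differentiable_dependence\<close>). The flow is given only on the loop, and
  nothing but the trajectories is known about it. Close trajectories stay close by Gronwall's
  inequality, applied until the first exit from a tube in which the velocity is Lipschitz. Their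
  difference quotients then solve the linearized equation approximately, and a second use of
  Gronwall shows that they converge to a solution \<open>W\<close>, which is therefore the tangent.\<close>

section \<open>Gronwall estimates\<close>

text \<open>The norm need not be differentiable at zero, so the classical differential inequality is
  applied to a majorant instead: \<open>\<Psi> r = norm (f 0) + \<integral>\<^sub>0\<^sup>r (K * norm (f q) + e) dq\<close> dominates the norm, is
  differentiable, and satisfies \<open>\<Psi>' \<le> K * \<Psi> + e\<close>.\<close>

lemma gronwall_norm:
  fixes f :: "real \<Rightarrow> 'a::banach"
  assumes der: "\<And>t. t \<in> {0..T} \<Longrightarrow> (f has_vector_derivative f' t) (at t within {0..T})"
    and bound: "\<And>t. t \<in> {0..T} \<Longrightarrow> norm (f' t) \<le> K * norm (f t) + e"
    and "0 \<le> K" "0 \<le> e" and t: "t \<in> {0..T}"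
  shows "norm (f t) \<le> (norm (f 0) + e * T) * exp (K * T)"
proof -
  define \<phi> where "\<phi> r = K * norm (f r) + e" for r
  define \<Psi> where "\<Psi> r = norm (f 0) + integral {0..r} \<phi>" for r
  have cf: "continuous_on {0..T} f"
    using der by (rule continuous_on_vector_derivative)
  have c\<phi>: "continuous_on {0..T} \<phi>"
    unfolding \<phi>_def by (intro continuous_intros cf)
  have f_le: "norm (f r) \<le> \<Psi> r" if r: "r \<in> {0..T}" for r
  proof -
    have "(f' has_integral (f r - f 0)) {0..r}"
      by (rule fundamental_theorem_of_calculus)
         (use r in \<open>auto intro: has_vector_derivative_within_subset[OF der]\<close>)
    moreover have "\<phi> integrable_on {0..r}"
      by (rule integrable_continuous_real) (use r in \<open>auto intro: continuous_on_subset[OF c\<phi>]\<close>)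
    ultimately have "norm (f r - f 0) \<le> integral {0..r} \<phi>"
      using integral_norm_bound_integral[of f' "{0..r}" \<phi>] bound r
      by (auto simp: \<phi>_def has_integral_iff)
    then show ?thesis
      unfolding \<Psi>_def using norm_triangle_ineq[of "f r - f 0" "f 0"] by simp
  qed
  have d\<Psi>: "(\<Psi> has_real_derivative \<phi> r) (at r within {0..T})" if "r \<in> {0..T}" for r
    unfolding \<Psi>_def
    using DERIV_add[OF DERIV_const integral_has_real_derivative[OF c\<phi> that], of "norm (f 0)"] by simp
  define h where "h r = \<Psi> r * exp (- K * r) - e * r" for r
  have dh: "(h has_real_derivative (\<phi> r - K * \<Psi> r) * exp (- K * r) - e) (at r within {0..T})"
    if "r \<in> {0..T}" for r
    unfolding h_def by (rule derivative_eq_intros d\<Psi>[OF that] refl | simp add: algebra_simps)+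
  \<comment> \<open>Since \<open>\<Psi>' - K * \<Psi> \<le> e\<close>, multiplying by \<open>exp (- K * r) \<le> 1\<close> still leaves at most \<open>e\<close>.\<close>
  have "h t \<le> h 0"
  proof (rule DERIV_nonpos_imp_decreasing_open[of 0 t h])
    show "0 \<le> t" using t by simp
    show "continuous_on {0..t} h"
      using t by (intro continuous_on_subset[OF DERIV_continuous_on[OF dh]]) auto
    fix r assume r: "0 < r" "r < t"
    then have rT: "r \<in> {0..T}" using t by simp
    have "(\<phi> r - K * \<Psi> r) * exp (- K * r) \<le> e * 1"
    proof (rule mult_mono)
      show "\<phi> r - K * \<Psi> r \<le> e"
        using mult_left_mono[OF f_le[OF rT] \<open>0 \<le> K\<close>] by (simp add: \<phi>_def)
      show "exp (- K * r) \<le> 1" using \<open>0 \<le> K\<close> r by simp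
    qed (use \<open>0 \<le> e\<close> in auto)
    moreover have "(h has_real_derivative (\<phi> r - K * \<Psi> r) * exp (- K * r) - e) (at r)"
      using dh[OF rT] r t by (simp add: at_within_Icc_at)
    ultimately show "\<exists>y. (h has_real_derivative y) (at r) \<and> y \<le> 0" by fastforce
  qed
  then have "\<Psi> t * exp (- K * t) \<le> norm (f 0) + e * t"
    by (simp add: h_def \<Psi>_def)
  then have "\<Psi> t \<le> (norm (f 0) + e * t) * exp (K * t)"
    by (simp add: exp_minus field_simps)
  also have "\<dots> \<le> (norm (f 0) + e * T) * exp (K * T)"
    using t \<open>0 \<le> K\<close> \<open>0 \<le> e\<close> by (intro mult_mono add_left_mono) (auto intro: mult_left_mono)
  finally show ?thesis using f_le[OF t] by simp
qed

text \<open>A velocity is Lipschitz only near a reference trajectory, so the growth rate is available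
  only while \<open>norm (f t) \<le> d\<close>. A first-exit argument removes this restriction for small initial
  values: up to the first time at which the norm equals \<open>d\<close>, Gronwall keeps it below \<open>d\<close>.\<close>

lemma gronwall_trapped:
  fixes f :: "real \<Rightarrow> 'a::banach"
  assumes der: "\<And>t. t \<in> {0..T} \<Longrightarrow> (f has_vector_derivative f' t) (at t within {0..T})"
    and bound: "\<And>t. t \<in> {0..T} \<Longrightarrow> norm (f t) \<le> d \<Longrightarrow> norm (f' t) \<le> K * norm (f t)"
    and "0 \<le> K" and small: "norm (f 0) * exp (K * T) < d" and t: "t \<in> {0..T}"
  shows "norm (f t) \<le> norm (f 0) * exp (K * T)"
proof -
  have cn: "continuous_on {0..T} (\<lambda>t. norm (f t))"
    by (rule continuous_on_norm[OF continuous_on_vector_derivative[OF der]])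
  have "0 \<le> T" using t by simp
  then have "norm (f 0) * 1 \<le> norm (f 0) * exp (K * T)"
    using \<open>0 \<le> K\<close> by (intro mult_left_mono) auto
  then have f0: "norm (f 0) < d" using small by simp
  have inside: "norm (f r) < d" if r: "r \<in> {0..T}" for r
  proof (rule ccontr)
    assume neg: "\<not> norm (f r) < d"
    define S where "S = {t \<in> {0..T}. norm (f t) = d}"
    have hit: "\<exists>x\<in>S. x \<le> q" if "q \<in> {0..T}" "\<not> norm (f q) < d" for q
    proof -
      have "\<exists>x. 0 \<le> x \<and> x \<le> q \<and> norm (f x) = d"
        using that f0 by (intro IVT' continuous_on_subset[OF cn]) auto
      then show ?thesis using that(1) by (auto simp: S_def)
    qed
    have "closed S"
      unfolding S_def by (rule continuous_closed_preimage_constant[OF cn]) simp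
    moreover have "bounded S"
      by (rule bounded_subset[of "{0..T}"]) (auto simp: S_def)
    ultimately have "compact S" by (simp add: compact_eq_bounded_closed)
    moreover have "S \<noteq> {}" using hit[OF r neg] by auto
    ultimately have "\<exists>t1\<in>S. \<forall>x\<in>S. t1 \<le> x" by (rule compact_attains_inf)
    then obtain t1 where t1: "t1 \<in> S" "\<And>x. x \<in> S \<Longrightarrow> t1 \<le> x" by blast
    have before: "norm (f q) \<le> d" if "q \<in> {0..t1}" for q
    proof (rule ccontr)
      assume "\<not> norm (f q) \<le> d"
      moreover have "q \<in> {0..T}" using that t1(1) by (simp add: S_def)
      ultimately obtain x where "x \<in> S" "x \<le> q" using hit[of q] by force
      then have "q = t1" using t1(2) that by fastforce
      then show False using t1(1) \<open>\<not> norm (f q) \<le> d\<close> by (simp add: S_def)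
    qed
    have "norm (f t1) \<le> (norm (f 0) + 0 * t1) * exp (K * t1)"
    proof (rule gronwall_norm)
      show "(f has_vector_derivative f' q) (at q within {0..t1})" if "q \<in> {0..t1}" for q
        using that t1(1) by (intro has_vector_derivative_within_subset[OF der]) (auto simp: S_def)
      show "norm (f' q) \<le> K * norm (f q) + 0" if "q \<in> {0..t1}" for q
        using bound[of q] before[OF that] that t1(1) by (auto simp: S_def)
    qed (use \<open>0 \<le> K\<close> t1(1) in \<open>auto simp: S_def\<close>)
    also have "\<dots> \<le> norm (f 0) * exp (K * T)"
      using t1(1) \<open>0 \<le> K\<close> by (auto simp: S_def intro!: mult_left_mono)
    finally show False using small t1(1) by (simp add: S_def)
  qed
  have "norm (f t) \<le> (norm (f 0) + 0 * T) * exp (K * T)"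
    by (rule gronwall_norm[OF der _ _ _ t])
       (use bound inside \<open>0 \<le> K\<close> in \<open>auto intro: less_imp_le\<close>)
  then show ?thesis by simp
qed

section \<open>Linear equations solved by approximation\<close>

text \<open>Existence for a linear equation without a fixed-point argument: by Gronwall, approximate
  solutions with vanishing defect and convergent initial values are uniformly Cauchy, and both
  they and their derivatives converge uniformly. Difference quotients of a
  flow are such approximations, their defect being the linearization error.\<close>

lemma linear_ode_of_approximate_solutions:
  fixes q :: "nat \<Rightarrow> real \<Rightarrow> 'a::banach" and A :: "real \<Rightarrow> 'a \<Rightarrow>\<^sub>L 'a"
  assumes "0 < T"
    and A: "\<And>t. t \<in> {0..T} \<Longrightarrow> norm (A t) \<le> L"
    and der: "\<And>n t. t \<in> {0..T} \<Longrightarrow> (q n has_vector_derivative q' n t) (at t within {0..T})"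
    and approx: "\<And>e. e > 0 \<Longrightarrow>
      \<forall>\<^sub>F n in sequentially. \<forall>t\<in>{0..T}. norm (q' n t - A t (q n t)) \<le> e"
    and init: "(\<lambda>n. q n 0) \<longlonglongrightarrow> w"
  shows "\<exists>W. W 0 = w \<and> (\<forall>t\<in>{0..T}. (W has_vector_derivative A t (W t)) (at t within {0..T}))"
proof -
  have "0 \<le> L" using A[of 0] \<open>0 < T\<close> norm_ge_zero[of "A 0"] by (simp del: norm_ge_zero)
  have Aw: "norm (A t x) \<le> L * norm x" if "t \<in> {0..T}" for t x
    by (rule order_trans[OF norm_blinfun]) (simp add: A[OF that] mult_right_mono)
  have "\<exists>N. \<forall>m n t. N \<le> m \<and> N \<le> n \<and> t \<in> {0..T} \<longrightarrow> dist (q m t) (q n t) < e" if "e > 0" for e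
  proof -
    define C where "C = (1 + 2 * T) * exp (L * T)"
    define e1 where "e1 = e / 2 / C"
    have "C > 0" using \<open>0 < T\<close> by (simp add: C_def)
    then have "e1 > 0" using \<open>e > 0\<close> by (simp add: e1_def)
    obtain N1 where N1: "\<And>n t. n \<ge> N1 \<Longrightarrow> t \<in> {0..T} \<Longrightarrow> norm (q' n t - A t (q n t)) \<le> e1"
      using approx[OF \<open>e1 > 0\<close>] unfolding eventually_sequentially by blast
    obtain N2 where N2: "\<And>m n. m \<ge> N2 \<Longrightarrow> n \<ge> N2 \<Longrightarrow> norm (q m 0 - q n 0) < e1"
      using LIMSEQ_imp_Cauchy[OF init] \<open>e1 > 0\<close> by (metis CauchyD)
    have "dist (q m t) (q n t) < e" if "max N1 N2 \<le> m" "max N1 N2 \<le> n" and t: "t \<in> {0..T}" for m n t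
    proof -
      have "norm (q m t - q n t) \<le> (norm (q m 0 - q n 0) + (2 * e1) * T) * exp (L * T)"
      proof (rule gronwall_norm[OF _ _ \<open>0 \<le> L\<close> _ t])
        fix r assume r: "r \<in> {0..T}"
        show "((\<lambda>t. q m t - q n t) has_vector_derivative q' m r - q' n r) (at r within {0..T})"
          by (intro has_vector_derivative_diff der r)
        have "q' m r - q' n r = A r (q m r - q n r) +
            ((q' m r - A r (q m r)) - (q' n r - A r (q n r)))"
          by (simp add: blinfun.diff_right)
        also have "norm \<dots> \<le> norm (A r (q m r - q n r)) +
            (norm (q' m r - A r (q m r)) + norm (q' n r - A r (q n r)))"
          by (intro norm_triangle_mono norm_triangle_ineq4 order_refl)
        also have "\<dots> \<le> L * norm (q m r - q n r) + (e1 + e1)"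
          using that r by (intro add_mono Aw N1) auto
        finally show "norm (q' m r - q' n r) \<le> L * norm (q m r - q n r) + 2 * e1" by simp
      qed (use \<open>e1 > 0\<close> in auto)
      also have "\<dots> \<le> (e1 + (2 * e1) * T) * exp (L * T)"
        using N2[of m n] that by (intro mult_right_mono add_right_mono) auto
      also have "\<dots> = e1 * C" by (simp add: C_def algebra_simps)
      also have "\<dots> = e / 2" using \<open>C > 0\<close> by (simp add: e1_def)
      finally show ?thesis using \<open>e > 0\<close> by (simp add: dist_norm)
    qed
    then show ?thesis by blast
  qed
  then obtain W where W: "\<And>e. e > 0 \<Longrightarrow> \<exists>N. \<forall>n t. N \<le> n \<and> t \<in> {0..T} \<longrightarrow> dist (q n t) (W t) < e"
    using uniformly_convergent_eq_cauchy[of "\<lambda>t. t \<in> {0..T}" q] by blast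
  have qW: "(\<lambda>n. q n t) \<longlonglongrightarrow> W t" if "t \<in> {0..T}" for t
    unfolding lim_sequentially using W that by meson
  have "\<exists>g. \<forall>t\<in>{0..T}. (\<lambda>n. q n t) \<longlonglongrightarrow> g t \<and>
      (g has_derivative (\<lambda>h. h *\<^sub>R A t (W t))) (at t within {0..T})"
  proof (rule has_derivative_sequence[where f' = "\<lambda>n t h. h *\<^sub>R q' n t"])
    show "(q n has_derivative (\<lambda>h. h *\<^sub>R q' n t)) (at t within {0..T})" if "t \<in> {0..T}" for n t
      using der[OF that] by (simp add: has_vector_derivative_def)
    fix e :: real assume "e > 0"
    define e1 where "e1 = e / (1 + L)"
    have "e1 > 0" using \<open>e > 0\<close> \<open>0 \<le> L\<close> by (simp add: e1_def)
    obtain N where N: "\<And>n t. N \<le> n \<Longrightarrow> t \<in> {0..T} \<Longrightarrow> dist (q n t) (W t) < e1"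
      using W[OF \<open>e1 > 0\<close>] by blast
    show "\<forall>\<^sub>F n in sequentially. \<forall>t\<in>{0..T}. \<forall>h. norm (h *\<^sub>R q' n t - h *\<^sub>R A t (W t)) \<le> e * norm h"
      using approx[OF \<open>e1 > 0\<close>] eventually_ge_at_top[of N]
    proof eventually_elim
      case (elim n)
      have "norm (h *\<^sub>R q' n t - h *\<^sub>R A t (W t)) \<le> e * norm h" if t: "t \<in> {0..T}" for t h
      proof -
        have "q' n t - A t (W t) = (q' n t - A t (q n t)) + A t (q n t - W t)"
          by (simp add: blinfun.diff_right)
        also have "norm \<dots> \<le> e1 + L * e1"
        proof (rule norm_triangle_mono)
          show "norm (A t (q n t - W t)) \<le> L * e1"
            using N[OF elim(2) t] \<open>0 \<le> L\<close>
            by (intro order_trans[OF Aw[OF t]] mult_left_mono) (auto simp: dist_norm)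
        qed (use elim t in blast)
        also have "\<dots> = e1 * (1 + L)" by (simp add: algebra_simps)
        also have "\<dots> = e" using \<open>0 \<le> L\<close> by (simp add: e1_def)
        finally show ?thesis
          by (simp add: mult_left_mono mult.commute[of e] flip: scaleR_diff_right)
      qed
      then show ?case by blast
    qed
  qed (use \<open>0 < T\<close> init in auto)
  then obtain g where g: "\<And>t. t \<in> {0..T} \<Longrightarrow> (\<lambda>n. q n t) \<longlonglongrightarrow> g t"
      "\<And>t. t \<in> {0..T} \<Longrightarrow> (g has_vector_derivative A t (W t)) (at t within {0..T})"
    unfolding has_vector_derivative_def by blast
  have "g t = W t" if "t \<in> {0..T}" for t
    using LIMSEQ_unique[OF g(1) qW] that by blast
  moreover have "g 0 = w" using LIMSEQ_unique[OF g(1) init] \<open>0 < T\<close> by simp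
  ultimately show ?thesis using g(2) by (intro exI[of _ g]) auto
qed

section \<open>Linearization of a velocity field along a trajectory\<close>

text \<open>\<open>Du t x\<close> is the spatial derivative, kept as a bounded linear map so that its continuity in
  time and space is continuity in operator norm.\<close>

locale C1_velocity =
  fixes T :: real and D :: "'a::euclidean_space set"
    and u :: "real \<Rightarrow> 'a \<Rightarrow> 'a" and Du :: "real \<Rightarrow> 'a \<Rightarrow> 'a \<Rightarrow>\<^sub>L 'a"
  assumes T_pos: "0 < T" and open_D: "open D"
    and u_deriv: "\<And>t x. t \<in> {0..T} \<Longrightarrow> x \<in> D \<Longrightarrow> (u t has_derivative Du t x) (at x)"
    and Du_cont: "continuous_on ({0..T} \<times> D) (\<lambda>(t, x). Du t x)"
begin

lemma Du_along_curve_bounded: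
  assumes x: "continuous_on {0..T} x" "x ` {0..T} \<subseteq> D"
  obtains L where "0 \<le> L" "\<And>t. t \<in> {0..T} \<Longrightarrow> norm (Du t (x t)) \<le> L"
proof -
  have "continuous_on {0..T} (\<lambda>t. case (t, x t) of (t, y) \<Rightarrow> Du t y)"
    by (rule continuous_on_compose2[OF Du_cont]) (use x in \<open>auto intro!: continuous_intros\<close>)
  then have "bounded ((\<lambda>t. Du t (x t)) ` {0..T})"
    by (intro compact_imp_bounded compact_continuous_image) auto
  then obtain L where "0 < L" "\<And>t. t \<in> {0..T} \<Longrightarrow> norm (Du t (x t)) \<le> L"
    unfolding bounded_pos by blast
  then show thesis using that[of L] by simp
qed

text \<open>The radius \<open>d\<close> is the same for all times. It comes from uniform continuity of \<open>Du\<close> on the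
  product of \<open>{0..T}\<close> with a closed tube around the compact trace of the curve; the estimate for
  \<open>u\<close> then follows from the mean value inequality on the convex ball around the curve point.\<close>

lemma linearization_along_curve:
  assumes x: "continuous_on {0..T} x" "x ` {0..T} \<subseteq> D" and "0 < e"
  shows "\<exists>d>0. (\<forall>t\<in>{0..T}. \<forall>y. norm (y - x t) \<le> d \<longrightarrow> norm (Du t y - Du t (x t)) \<le> e) \<and>
    (\<forall>t\<in>{0..T}. \<forall>y. norm (y - x t) \<le> d \<longrightarrow>
      norm (u t y - u t (x t) - Du t (x t) (y - x t)) \<le> e * norm (y - x t))"
proof -
  have "compact (x ` {0..T})" using x by (intro compact_continuous_image) auto
  then obtain r where r: "0 < r" "(\<Union>z\<in>x ` {0..T}. cball z r) \<subseteq> D"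
    using compact_subset_open_imp_cball_epsilon_subset[OF _ open_D x(2)] by blast
  define C where "C = (\<Union>z\<in>x ` {0..T}. cball z r)"
  have "compact ({0..T} \<times> C)"
    unfolding C_def
    by (intro compact_Times compact_minkowski_sum_cball \<open>compact (x ` {0..T})\<close>) simp
  moreover have "continuous_on ({0..T} \<times> C) (\<lambda>(t, x). Du t x)"
    using r by (intro continuous_on_subset[OF Du_cont]) (auto simp: C_def)
  ultimately have "uniformly_continuous_on ({0..T} \<times> C) (\<lambda>(t, x). Du t x)"
    by (rule compact_uniformly_continuous[rotated])
  from uniformly_continuous_onE[OF this \<open>0 < e\<close>] obtain d0 where d0: "0 < d0"
    "\<And>p p'. p \<in> {0..T} \<times> C \<Longrightarrow> p' \<in> {0..T} \<times> C \<Longrightarrow> dist p' p < d0 \<Longrightarrow>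
      dist (case p' of (t, x) \<Rightarrow> Du t x) (case p of (t, x) \<Rightarrow> Du t x) < e" by blast
  define d where "d = min r (d0 / 2)"
  have "0 < d" "d \<le> r" "d < d0" using r(1) d0(1) by (auto simp: d_def)
  have inC: "y \<in> C" if "t \<in> {0..T}" "norm (y - x t) \<le> d" for t y
    using that \<open>d \<le> r\<close> by (auto simp: C_def dist_norm norm_minus_commute intro!: bexI[of _ t])
  have close: "norm (Du t y - Du t (x t)) \<le> e" if t: "t \<in> {0..T}" and y: "norm (y - x t) \<le> d" for t y
  proof -
    have "dist (t, y) (t, x t) < d0"
      using y \<open>d < d0\<close> by (simp add: dist_Pair_Pair dist_norm)
    then have "dist (Du t y) (Du t (x t)) < e"
      using d0(2)[of "(t, x t)" "(t, y)"] inC[OF t y] inC[OF t, of "x t"] t \<open>0 < d\<close> by simp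
    then show ?thesis by (simp add: dist_norm)
  qed
  have lin: "norm (u t y - u t (x t) - Du t (x t) (y - x t)) \<le> e * norm (y - x t)"
    if t: "t \<in> {0..T}" and y: "norm (y - x t) \<le> d" for t y
  proof -
    let ?S = "cball (x t) d"
    have "norm (u t y - u t (x t) - Du t (x t) (y - x t)) \<le> norm (y - x t) * e"
    proof (rule differentiable_bound_linearization[where S = ?S and f' = "\<lambda>z. blinfun_apply (Du t z)"])
      show "x t + s *\<^sub>R (y - x t) \<in> ?S" if "s \<in> {0..1}" for s
      proof -
        have "\<bar>s\<bar> * norm (y - x t) \<le> 1 * d" using that y by (intro mult_mono) auto
        then show ?thesis by (simp add: dist_norm)
      qed
      fix z assume z: "z \<in> ?S"
      then have zn: "norm (z - x t) \<le> d" by (simp add: dist_norm norm_minus_commute)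
      have "z \<in> D" using inC[OF t zn] r(2) unfolding C_def by blast
      then show "(u t has_derivative Du t z) (at z within ?S)"
        using u_deriv[OF t] has_derivative_at_withinI by blast
      have "blinfun_apply (Du t z) - blinfun_apply (Du t (x t)) = blinfun_apply (Du t z - Du t (x t))"
        by (simp add: fun_eq_iff blinfun.diff_left)
      then show "onorm (blinfun_apply (Du t z) - blinfun_apply (Du t (x t))) \<le> e"
        using close[OF t zn] by (simp only: norm_blinfun.rep_eq[symmetric])
    qed (use \<open>0 < d\<close> in auto)
    then show ?thesis by (simp add: mult.commute)
  qed
  show ?thesis using \<open>0 < d\<close> close lin by blast
qed

end

section \<open>Differentiable dependence on the initial curve\<close>

lemma jointly_continuous_if_equicontinuous:
  fixes F :: "real \<Rightarrow> real \<Rightarrow> 'a::real_normed_vector"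
  assumes "\<And>s. s \<in> {0..1} \<Longrightarrow> continuous_on {0..T} (\<lambda>t. F t s)"
    and eq: "\<And>s0 e. s0 \<in> {0..1} \<Longrightarrow> 0 < e \<Longrightarrow>
      \<forall>\<^sub>F s in at s0 within {0..1}. \<forall>t\<in>{0..T}. norm (F t s - F t s0) < e"
  shows "continuous_on ({0..T} \<times> {0..1}) (\<lambda>(t, s). F t s)"
proof (rule continuous_onI)
  fix p e assume p: "p \<in> {0..T} \<times> {0..1::real}" and "(0::real) < e"
  obtain t0 s0 where p_eq: "p = (t0, s0)" and t0: "t0 \<in> {0..T}" and s0: "s0 \<in> {0..1}"
    using p by auto
  obtain d1 where d1: "0 < d1" "\<And>t. t \<in> {0..T} \<Longrightarrow> dist t t0 < d1 \<Longrightarrow> dist (F t s0) (F t0 s0) < e / 2"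
    using assms(1)[OF s0] t0 \<open>0 < e\<close> unfolding continuous_on_iff by (meson half_gt_zero)
  obtain d2 where d2: "0 < d2" "\<And>s t. s \<in> {0..1} \<Longrightarrow> s \<noteq> s0 \<Longrightarrow> dist s s0 < d2 \<Longrightarrow> t \<in> {0..T} \<Longrightarrow>
      norm (F t s - F t s0) < e / 2"
    using eq[OF s0, of "e / 2"] \<open>0 < e\<close> unfolding eventually_at by (auto simp: Ball_def)
  show "\<exists>d>0. \<forall>x'\<in>{0..T} \<times> {0..1}. dist x' p < d \<longrightarrow>
      dist (case x' of (t, s) \<Rightarrow> F t s) (case p of (t, s) \<Rightarrow> F t s) \<le> e"
  proof (intro exI[of _ "min d1 d2"] conjI ballI impI)
    show "0 < min d1 d2" using d1 d2 by simp
    fix x' assume "x' \<in> {0..T} \<times> {0..1::real}" and near: "dist x' p < min d1 d2"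
    then obtain t s where x': "x' = (t, s)" "t \<in> {0..T}" "s \<in> {0..1}" by auto
    have "dist t t0 < d1" "dist s s0 < d2"
      using near dist_fst_le[of x' p] dist_snd_le[of x' p] by (auto simp: x' p_eq)
    then have "dist (F t s0) (F t0 s0) < e / 2" "dist (F t s) (F t s0) < e / 2"
      using d1(2) d2(2)[of s t] x' \<open>0 < e\<close> by (cases "s = s0"; simp add: dist_norm)+
    then have "dist (F t s) (F t0 s0) < e" using dist_triangle[of "F t s" "F t0 s0" "F t s0"] by linarith
    then show "dist (case x' of (t, s) \<Rightarrow> F t s) (case p of (t, s) \<Rightarrow> F t s) \<le> e"
      by (simp add: x' p_eq)
  qed
qed

text \<open>\<open>X t s\<close> is the position at time \<open>t\<close> of the particle with label \<open>s\<close>. Only the particles of the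
  curve are followed: the flow of a neighbourhood is not assumed to exist, so the tangent of
  \<open>X t\<close> has to be found from these trajectories alone.\<close>

locale transported_curve = C1_velocity T D u Du
  for T :: real and D :: "'a::euclidean_space set" and u Du +
  fixes X :: "real \<Rightarrow> real \<Rightarrow> 'a" and c' :: "real \<Rightarrow> 'a"
  assumes X_in: "\<And>t s. t \<in> {0..T} \<Longrightarrow> s \<in> {0..1} \<Longrightarrow> X t s \<in> D"
    and X_ode: "\<And>t s. t \<in> {0..T} \<Longrightarrow> s \<in> {0..1} \<Longrightarrow>
      ((\<lambda>t. X t s) has_vector_derivative u t (X t s)) (at t within {0..T})"
    and X_init: "\<And>s. s \<in> {0..1} \<Longrightarrow> (X 0 has_vector_derivative c' s) (at s within {0..1})"
    and c'_cont: "continuous_on {0..1} c'"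
begin

lemma trajectory:
  assumes "s \<in> {0..1}"
  shows "continuous_on {0..T} (\<lambda>t. X t s)" "(\<lambda>t. X t s) ` {0..T} \<subseteq> D"
  using X_in[OF _ assms] continuous_on_vector_derivative[OF X_ode[OF _ assms]] by auto

text \<open>Near the trajectory of \<open>s0\<close> the velocity has Lipschitz constant \<open>L + 1\<close>, with \<open>L\<close> a bound for
  \<open>Du\<close> on that trajectory. For labels close to \<open>s0\<close> the distance of the two particles starts small
  enough for the trapped form of Gronwall's inequality.\<close>

lemma X_lipschitz:
  assumes s0: "s0 \<in> {0..1}"
  shows "\<exists>M>0. \<forall>\<^sub>F s in at s0 within {0..1}. \<forall>t\<in>{0..T}.
    norm (X t s - X t s0) \<le> M * \<bar>s - s0\<bar>"
proof -
  note tr = trajectory[OF s0]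
  obtain L where L: "0 \<le> L" "\<And>t. t \<in> {0..T} \<Longrightarrow> norm (Du t (X t s0)) \<le> L"
    using Du_along_curve_bounded[OF tr] by blast
  obtain d where d: "0 < d"
    "\<forall>t\<in>{0..T}. \<forall>y. norm (y - X t s0) \<le> d \<longrightarrow> norm (Du t y - Du t (X t s0)) \<le> 1"
    "\<forall>t\<in>{0..T}. \<forall>y. norm (y - X t s0) \<le> d \<longrightarrow>
      norm (u t y - u t (X t s0) - Du t (X t s0) (y - X t s0)) \<le> 1 * norm (y - X t s0)"
    using linearization_along_curve[OF tr zero_less_one] by blast
  define E where "E = exp ((L + 1) * T)"
  have "E > 0" by (simp add: E_def)
  define M where "M = (norm (c' s0) + 1) * E"
  have "M > 0" using \<open>E > 0\<close> by (simp add: M_def add_nonneg_pos)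
  have init: "\<forall>\<^sub>F s in at s0 within {0..1}. norm (X 0 s - X 0 s0) \<le> (norm (c' s0) + 1) * \<bar>s - s0\<bar>"
  proof -
    have "\<forall>\<^sub>F s in at s0 within {0..1}. norm (X 0 s - X 0 s0 - (s - s0) *\<^sub>R c' s0) \<le> 1 * norm (s - s0)"
      using X_init[OF s0] zero_less_one unfolding has_vector_derivative_def has_derivative_within_alt2 by blast
    then show ?thesis
    proof eventually_elim
      case (elim s)
      have "norm (X 0 s - X 0 s0) \<le> norm (X 0 s - X 0 s0 - (s - s0) *\<^sub>R c' s0) + norm ((s - s0) *\<^sub>R c' s0)"
        using norm_triangle_ineq[of "X 0 s - X 0 s0 - (s - s0) *\<^sub>R c' s0" "(s - s0) *\<^sub>R c' s0"] by simp
      also have "norm ((s - s0) *\<^sub>R c' s0) = norm (c' s0) * \<bar>s - s0\<bar>" by simp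
      finally show ?case using elim by (simp add: distrib_right)
    qed
  qed
  have "\<forall>\<^sub>F s in at s0 within {0..1}. M * \<bar>s - s0\<bar> < d"
  proof (rule order_tendstoD(2))
    show "((\<lambda>s. M * \<bar>s - s0\<bar>) \<longlongrightarrow> M * \<bar>s0 - s0\<bar>) (at s0 within {0..1})"
      by (intro tendsto_intros)
  qed (use d in simp)
  moreover have "\<forall>\<^sub>F s in at s0 within {0..1}. s \<in> {0..1}"
    by (simp add: eventually_at_filter)
  ultimately have "\<forall>\<^sub>F s in at s0 within {0..1}. \<forall>t\<in>{0..T}. norm (X t s - X t s0) \<le> M * \<bar>s - s0\<bar>"
    using init
  proof eventually_elim
    case (elim s)
    have small: "norm (X 0 s - X 0 s0) * E \<le> M * \<bar>s - s0\<bar>"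
      using mult_right_mono[OF elim(3), of E] \<open>E > 0\<close> by (simp add: M_def algebra_simps)
    show ?case
    proof
      fix t assume t: "t \<in> {0..T}"
      have "norm (X t s - X t s0) \<le> norm (X 0 s - X 0 s0) * exp ((L + 1) * T)"
      proof (rule gronwall_trapped[OF _ _ _ _ t])
        show "norm (X 0 s - X 0 s0) * exp ((L + 1) * T) < d"
          using small elim(1) by (simp add: E_def)
        fix r assume r: "r \<in> {0..T}"
        show "((\<lambda>t. X t s - X t s0) has_vector_derivative u r (X r s) - u r (X r s0)) (at r within {0..T})"
          by (intro has_vector_derivative_diff X_ode r elim s0)
        assume near: "norm (X r s - X r s0) \<le> d"
        have "u r (X r s) - u r (X r s0) = Du r (X r s0) (X r s - X r s0) +
            (u r (X r s) - u r (X r s0) - Du r (X r s0) (X r s - X r s0))" by simp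
        also have "norm \<dots> \<le> L * norm (X r s - X r s0) + 1 * norm (X r s - X r s0)"
        proof (rule norm_triangle_mono[OF _ d(3)[rule_format, OF r near]])
          show "norm (Du r (X r s0) (X r s - X r s0)) \<le> L * norm (X r s - X r s0)"
            by (rule order_trans[OF norm_blinfun]) (intro mult_right_mono L r, simp)
        qed
        finally show "norm (u r (X r s) - u r (X r s0)) \<le> (L + 1) * norm (X r s - X r s0)"
          by (simp add: algebra_simps)
      qed (use L in simp)
      then show "norm (X t s - X t s0) \<le> M * \<bar>s - s0\<bar>" using small by (simp add: E_def)
    qed
  qed
  then show ?thesis using \<open>M > 0\<close> by blast
qed

lemma X_equicontinuous:
  assumes s0: "s0 \<in> {0..1}" and "0 < d"
  shows "\<forall>\<^sub>F s in at s0 within {0..1}. \<forall>t\<in>{0..T}. norm (X t s - X t s0) < d"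
proof -
  obtain M where M: "0 < M"
    "\<forall>\<^sub>F s in at s0 within {0..1}. \<forall>t\<in>{0..T}. norm (X t s - X t s0) \<le> M * \<bar>s - s0\<bar>"
    using X_lipschitz[OF s0] by blast
  have "\<forall>\<^sub>F s in at s0 within {0..1}. M * \<bar>s - s0\<bar> < d"
  proof (rule order_tendstoD(2))
    show "((\<lambda>s. M * \<bar>s - s0\<bar>) \<longlongrightarrow> M * \<bar>s0 - s0\<bar>) (at s0 within {0..1})"
      by (intro tendsto_intros)
  qed (use \<open>0 < d\<close> in simp)
  with M(2) show ?thesis by eventually_elim fastforce
qed

lemma velocity_difference_linearized:
  assumes s0: "s0 \<in> {0..1}" and "0 < e"
  shows "\<forall>\<^sub>F s in at s0 within {0..1}. \<forall>t\<in>{0..T}.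
    norm (u t (X t s) - u t (X t s0) - Du t (X t s0) (X t s - X t s0)) \<le> e * \<bar>s - s0\<bar>"
proof -
  obtain M where M: "0 < M"
    "\<forall>\<^sub>F s in at s0 within {0..1}. \<forall>t\<in>{0..T}. norm (X t s - X t s0) \<le> M * \<bar>s - s0\<bar>"
    using X_lipschitz[OF s0] by blast
  have "0 < e / M" using M \<open>0 < e\<close> by simp
  obtain d where d: "0 < d"
    "\<forall>t\<in>{0..T}. \<forall>y. norm (y - X t s0) \<le> d \<longrightarrow> norm (Du t y - Du t (X t s0)) \<le> e / M"
    "\<forall>t\<in>{0..T}. \<forall>y. norm (y - X t s0) \<le> d \<longrightarrow>
      norm (u t y - u t (X t s0) - Du t (X t s0) (y - X t s0)) \<le> e / M * norm (y - X t s0)"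
    using linearization_along_curve[OF trajectory[OF s0] \<open>0 < e / M\<close>] by blast
  from M(2) X_equicontinuous[OF s0 \<open>0 < d\<close>] show ?thesis
  proof eventually_elim
    case (elim s)
    show ?case
    proof
      fix t assume t: "t \<in> {0..T}"
      have "norm (u t (X t s) - u t (X t s0) - Du t (X t s0) (X t s - X t s0)) \<le>
          e / M * norm (X t s - X t s0)"
        using elim(2) t by (intro d(3)[rule_format]) (auto intro: less_imp_le)
      also have "\<dots> \<le> e / M * (M * \<bar>s - s0\<bar>)"
        using elim(1) t M(1) \<open>0 < e\<close> by (intro mult_left_mono) auto
      finally show "norm (u t (X t s) - u t (X t s0) - Du t (X t s0) (X t s - X t s0)) \<le> e * \<bar>s - s0\<bar>"
        using M(1) by simp
    qed
  qed
qed

text \<open>The equation for \<open>W\<close> is the one satisfied by the tangent vector of a material curve. The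
  difference quotients of \<open>X\<close> along a sequence of labels tending to \<open>s0\<close> solve it up to a defect
  that tends to zero uniformly in time.\<close>

lemma variational_solution_exists:
  assumes s0: "s0 \<in> {0..1}"
  shows "\<exists>W. W 0 = c' s0 \<and>
    (\<forall>t\<in>{0..T}. (W has_vector_derivative Du t (X t s0) (W t)) (at t within {0..T}))"
proof -
  have "s0 islimpt {0..1}" using s0 by simp
  then obtain \<sigma> :: "nat \<Rightarrow> real" where \<sigma>: "\<And>n. \<sigma> n \<in> {0..1} - {s0}" "\<sigma> \<longlonglongrightarrow> s0"
    unfolding islimpt_sequential by blast
  have flt: "filterlim \<sigma> (at s0 within {0..1}) sequentially"
    using \<sigma> by (auto simp: filterlim_at intro!: always_eventually)
  obtain L where L: "\<And>t. t \<in> {0..T} \<Longrightarrow> norm (Du t (X t s0)) \<le> L"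
    using Du_along_curve_bounded[OF trajectory[OF s0]] by blast
  define h where "h n = \<sigma> n - s0" for n
  have h: "h n \<noteq> 0" for n using \<sigma>(1)[of n] by (auto simp: h_def)
  define q where "q n t = (X t (\<sigma> n) - X t s0) /\<^sub>R h n" for n t
  define q' where "q' n t = (u t (X t (\<sigma> n)) - u t (X t s0)) /\<^sub>R h n" for n t
  show ?thesis
  proof (rule linear_ode_of_approximate_solutions[where A = "\<lambda>t. Du t (X t s0)" and q = q and q' = q', OF T_pos L])
    show "(q n has_vector_derivative q' n t) (at t within {0..T})" if "t \<in> {0..T}" for n t
      unfolding q_def q'_def using that \<sigma>(1)[of n] s0
      by (intro bounded_linear.has_vector_derivative[OF bounded_linear_scaleR_right]
          has_vector_derivative_diff X_ode) auto
    show "(\<lambda>n. q n 0) \<longlonglongrightarrow> c' s0"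
    proof -
      have "((\<lambda>s. (X 0 s - X 0 s0) /\<^sub>R (s - s0)) \<longlongrightarrow> c' s0) (at s0 within {0..1})"
      proof (rule tendstoI)
        fix e :: real assume "0 < e"
        then have "\<forall>\<^sub>F s in at s0 within {0..1}. norm (X 0 s - X 0 s0 - (s - s0) *\<^sub>R c' s0) \<le> e / 2 * norm (s - s0)"
          using X_init[OF s0] unfolding has_vector_derivative_def has_derivative_within_alt2
          by (meson half_gt_zero)
        moreover have "\<forall>\<^sub>F s in at s0 within {0..1}. s \<noteq> s0"
          by (simp add: eventually_at_filter)
        ultimately show "\<forall>\<^sub>F s in at s0 within {0..1}. dist ((X 0 s - X 0 s0) /\<^sub>R (s - s0)) (c' s0) < e"
        proof eventually_elim
          case (elim s)
          then have "(X 0 s - X 0 s0) /\<^sub>R (s - s0) - c' s0 = (X 0 s - X 0 s0 - (s - s0) *\<^sub>R c' s0) /\<^sub>R (s - s0)"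
            by (simp add: scaleR_diff_right)
          then have "dist ((X 0 s - X 0 s0) /\<^sub>R (s - s0)) (c' s0) \<le> e / 2"
            using elim by (simp add: dist_norm divide_simps)
          then show ?case using \<open>0 < e\<close> by simp
        qed
      qed
      from filterlim_compose[OF this flt] show ?thesis by (simp add: q_def h_def)
    qed
    fix e :: real assume "0 < e"
    have "\<forall>\<^sub>F n in sequentially. \<forall>t\<in>{0..T}. norm (u t (X t (\<sigma> n)) - u t (X t s0) -
        Du t (X t s0) (X t (\<sigma> n) - X t s0)) \<le> e * \<bar>\<sigma> n - s0\<bar>"
      using eventually_compose_filterlim[OF velocity_difference_linearized[OF s0 \<open>0 < e\<close>] flt] .
    then show "\<forall>\<^sub>F n in sequentially. \<forall>t\<in>{0..T}. norm (q' n t - Du t (X t s0) (q n t)) \<le> e"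
    proof eventually_elim
      case (elim n)
      show ?case
      proof
        fix t assume t: "t \<in> {0..T}"
        have "q' n t - Du t (X t s0) (q n t) =
            (u t (X t (\<sigma> n)) - u t (X t s0) - Du t (X t s0) (X t (\<sigma> n) - X t s0)) /\<^sub>R h n"
          by (simp add: q_def q'_def blinfun.scaleR_right blinfun.diff_right scaleR_diff_right)
        then show "norm (q' n t - Du t (X t s0) (q n t)) \<le> e"
          using elim[rule_format, OF t] h[of n] by (simp add: h_def[symmetric] divide_simps)
      qed
    qed
  qed
qed

text \<open>The remainder \<open>X t s - X t s0 - (s - s0) *\<^sub>R W t\<close> solves the linearized equation up to a
  defect \<open>o(s - s0)\<close> and starts at \<open>o(s - s0)\<close>, hence stays \<open>o(s - s0)\<close> by Gronwall.\<close>

lemma X_differentiable_in_parameter: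
  assumes s0: "s0 \<in> {0..1}" and t: "t \<in> {0..T}" and W0: "W 0 = c' s0"
    and W: "\<And>t. t \<in> {0..T} \<Longrightarrow> (W has_vector_derivative Du t (X t s0) (W t)) (at t within {0..T})"
  shows "(X t has_vector_derivative W t) (at s0 within {0..1})"
  unfolding has_vector_derivative_def has_derivative_within_alt2
proof (intro conjI allI impI)
  show "bounded_linear (\<lambda>h. h *\<^sub>R W t)" by (rule bounded_linear_scaleR_left)
  fix e :: real assume "0 < e"
  obtain L where L: "0 \<le> L" "\<And>t. t \<in> {0..T} \<Longrightarrow> norm (Du t (X t s0)) \<le> L"
    using Du_along_curve_bounded[OF trajectory[OF s0]] by blast
  define C where "C = (1 + T) * exp (L * T)"
  have "C > 0" using T_pos by (simp add: C_def)
  define e1 where "e1 = e / C"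
  have "e1 > 0" using \<open>C > 0\<close> \<open>0 < e\<close> by (simp add: e1_def)
  have "\<forall>\<^sub>F s in at s0 within {0..1}. norm (X 0 s - X 0 s0 - (s - s0) *\<^sub>R c' s0) \<le> e1 * norm (s - s0)"
    using X_init[OF s0] \<open>e1 > 0\<close> unfolding has_vector_derivative_def has_derivative_within_alt2 by blast
  moreover have "\<forall>\<^sub>F s in at s0 within {0..1}. s \<in> {0..1}"
    by (simp add: eventually_at_filter)
  ultimately show "\<forall>\<^sub>F s in at s0 within {0..1}. norm (X t s - X t s0 - (s - s0) *\<^sub>R W t) \<le> e * norm (s - s0)"
    using velocity_difference_linearized[OF s0 \<open>e1 > 0\<close>]
  proof eventually_elim
    case (elim s)
    have "norm (X t s - X t s0 - (s - s0) *\<^sub>R W t) \<le>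
        (norm (X 0 s - X 0 s0 - (s - s0) *\<^sub>R W 0) + (e1 * \<bar>s - s0\<bar>) * T) * exp (L * T)"
    proof (rule gronwall_norm[OF _ _ L(1) _ t])
      fix r assume r: "r \<in> {0..T}"
      let ?A = "Du r (X r s0)"
      show "((\<lambda>t. X t s - X t s0 - (s - s0) *\<^sub>R W t) has_vector_derivative
          u r (X r s) - u r (X r s0) - (s - s0) *\<^sub>R ?A (W r)) (at r within {0..T})"
        by (intro has_vector_derivative_diff X_ode r elim s0
            bounded_linear.has_vector_derivative[OF bounded_linear_scaleR_right] W)
      have "u r (X r s) - u r (X r s0) - (s - s0) *\<^sub>R ?A (W r) =
          ?A (X r s - X r s0 - (s - s0) *\<^sub>R W r) +
          (u r (X r s) - u r (X r s0) - ?A (X r s - X r s0))"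
        by (simp add: blinfun.diff_right blinfun.scaleR_right)
      also have "norm \<dots> \<le> L * norm (X r s - X r s0 - (s - s0) *\<^sub>R W r) + e1 * \<bar>s - s0\<bar>"
        using elim r
        by (intro norm_triangle_mono order_trans[OF norm_blinfun] mult_right_mono L) auto
      finally show "norm (u r (X r s) - u r (X r s0) - (s - s0) *\<^sub>R ?A (W r)) \<le>
          L * norm (X r s - X r s0 - (s - s0) *\<^sub>R W r) + e1 * \<bar>s - s0\<bar>" .
    qed (use \<open>e1 > 0\<close> in simp)
    also have "\<dots> \<le> (e1 * \<bar>s - s0\<bar> + (e1 * \<bar>s - s0\<bar>) * T) * exp (L * T)"
      using elim(1) by (intro mult_right_mono add_right_mono) (auto simp: W0)
    also have "\<dots> = (e1 * C) * \<bar>s - s0\<bar>" by (simp add: C_def algebra_simps)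
    also have "\<dots> = e * norm (s - s0)" using \<open>C > 0\<close> by (simp add: e1_def)
    finally show ?case .
  qed
qed

text \<open>Moving the label perturbs both the coefficient \<open>Du t (X t s)\<close> and the initial value by a
  small amount, uniformly in time. Together with continuity in time this yields the joint
  continuity of the tangent vectors that differentiation under the integral sign requires.\<close>

lemma variational_solution_equicontinuous:
  assumes s0: "s0 \<in> {0..1}" and "0 < e"
    and W0: "\<And>s. s \<in> {0..1} \<Longrightarrow> W 0 s = c' s"
    and W: "\<And>t s. t \<in> {0..T} \<Longrightarrow> s \<in> {0..1} \<Longrightarrow>
      ((\<lambda>t. W t s) has_vector_derivative Du t (X t s) (W t s)) (at t within {0..T})"
  shows "\<forall>\<^sub>F s in at s0 within {0..1}. \<forall>t\<in>{0..T}. norm (W t s - W t s0) < e"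
proof -
  note tr = trajectory[OF s0]
  obtain L where L: "0 \<le> L" "\<And>t. t \<in> {0..T} \<Longrightarrow> norm (Du t (X t s0)) \<le> L"
    using Du_along_curve_bounded[OF tr] by blast
  have "bounded ((\<lambda>t. W t s0) ` {0..T})"
    using continuous_on_vector_derivative[OF W[OF _ s0]]
    by (intro compact_imp_bounded compact_continuous_image) auto
  then obtain B where B: "0 < B" "\<And>t. t \<in> {0..T} \<Longrightarrow> norm (W t s0) \<le> B"
    unfolding bounded_pos by blast
  define C where "C = (1 + B * T) * exp ((L + 1) * T)"
  have "C > 0" using T_pos B(1) by (simp add: C_def add_pos_pos)
  define e1 where "e1 = min 1 (e / 2 / C)"
  have "e1 > 0" "e1 \<le> 1" "e1 \<le> e / 2 / C"
    using \<open>C > 0\<close> \<open>0 < e\<close> by (auto simp: e1_def)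
  obtain d where d: "0 < d"
    "\<forall>t\<in>{0..T}. \<forall>y. norm (y - X t s0) \<le> d \<longrightarrow> norm (Du t y - Du t (X t s0)) \<le> e1"
    "\<forall>t\<in>{0..T}. \<forall>y. norm (y - X t s0) \<le> d \<longrightarrow>
      norm (u t y - u t (X t s0) - Du t (X t s0) (y - X t s0)) \<le> e1 * norm (y - X t s0)"
    using linearization_along_curve[OF tr \<open>e1 > 0\<close>] by blast
  have "\<forall>\<^sub>F s in at s0 within {0..1}. dist (c' s) (c' s0) < e1"
    using c'_cont s0 \<open>e1 > 0\<close> unfolding continuous_on_def by (blast dest: tendstoD)
  moreover have "\<forall>\<^sub>F s in at s0 within {0..1}. s \<in> {0..1}"
    by (simp add: eventually_at_filter)
  ultimately show ?thesis
    using X_equicontinuous[OF s0 \<open>0 < d\<close>]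
  proof eventually_elim
    case (elim s)
    have "norm (W t s - W t s0) < e" if t: "t \<in> {0..T}" for t
    proof -
      have "norm (W t s - W t s0) \<le> (norm (W 0 s - W 0 s0) + (e1 * B) * T) * exp ((L + 1) * T)"
      proof (rule gronwall_norm[OF _ _ _ _ t])
        fix r assume r: "r \<in> {0..T}"
        let ?A = "Du r (X r s)" and ?B = "Du r (X r s0)"
        show "((\<lambda>t. W t s - W t s0) has_vector_derivative ?A (W r s) - ?B (W r s0)) (at r within {0..T})"
          by (rule has_vector_derivative_diff[OF W[OF r elim(2)] W[OF r s0]])
        have diff: "norm (?A - ?B) \<le> e1"
          using elim(3) r by (intro d(2)[rule_format]) (auto intro: less_imp_le)
        have "norm ?A \<le> norm ?B + norm (?A - ?B)" by (rule norm_triangle_sub)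
        also have "\<dots> \<le> L + 1" using L(2)[OF r] diff \<open>e1 \<le> 1\<close> by linarith
        finally have A: "norm ?A \<le> L + 1" .
        have "?A (W r s) - ?B (W r s0) = ?A (W r s - W r s0) + (?A - ?B) (W r s0)"
          by (simp add: blinfun.diff_right blinfun.diff_left)
        also have "norm \<dots> \<le> (L + 1) * norm (W r s - W r s0) + e1 * B"
        proof (rule norm_triangle_mono)
          show "norm (?A (W r s - W r s0)) \<le> (L + 1) * norm (W r s - W r s0)"
            by (rule order_trans[OF norm_blinfun]) (intro mult_right_mono A, simp)
          show "norm ((?A - ?B) (W r s0)) \<le> e1 * B"
            by (rule order_trans[OF norm_blinfun]) (intro mult_mono diff B r, use \<open>e1 > 0\<close> in simp_all)
        qed
        finally show "norm (?A (W r s) - ?B (W r s0)) \<le> (L + 1) * norm (W r s - W r s0) + e1 * B" .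
      qed (use L \<open>e1 > 0\<close> B(1) in simp_all)
      also have "\<dots> \<le> (e1 + (e1 * B) * T) * exp ((L + 1) * T)"
        using elim(1,2) s0 by (intro mult_right_mono add_right_mono) (auto simp: W0 dist_norm)
      also have "\<dots> = e1 * C" by (simp add: C_def algebra_simps)
      also have "\<dots> \<le> e / 2" using \<open>e1 \<le> e / 2 / C\<close> \<open>C > 0\<close> by (simp add: field_simps)
      finally show ?thesis using \<open>0 < e\<close> by simp
    qed
    then show ?case by blast
  qed
qed

lemma differentiable_dependence:
  obtains W where
    "continuous_on ({0..T} \<times> {0..1}) (\<lambda>(t, s). X t s)"
    "continuous_on ({0..T} \<times> {0..1}) (\<lambda>(t, s). W t s)"
    "\<And>t s. t \<in> {0..T} \<Longrightarrow> s \<in> {0..1} \<Longrightarrow> (X t has_vector_derivative W t s) (at s within {0..1})"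
    "\<And>t s. t \<in> {0..T} \<Longrightarrow> s \<in> {0..1} \<Longrightarrow>
      ((\<lambda>t. W t s) has_vector_derivative Du t (X t s) (W t s)) (at t within {0..T})"
proof -
  obtain V where V: "\<And>s. s \<in> {0..1} \<Longrightarrow> V s 0 = c' s"
    "\<And>t s. t \<in> {0..T} \<Longrightarrow> s \<in> {0..1} \<Longrightarrow>
      (V s has_vector_derivative Du t (X t s) (V s t)) (at t within {0..T})"
    using variational_solution_exists by metis
  show thesis
  proof (rule that[of "\<lambda>t s. V s t"])
    show "continuous_on ({0..T} \<times> {0..1}) (\<lambda>(t, s). X t s)"
      by (rule jointly_continuous_if_equicontinuous) (auto intro: trajectory X_equicontinuous)
    show "continuous_on ({0..T} \<times> {0..1}) (\<lambda>(t, s). V s t)"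
    proof (rule jointly_continuous_if_equicontinuous)
      show "continuous_on {0..T} (\<lambda>t. V s t)" if "s \<in> {0..1}" for s
        using continuous_on_vector_derivative[OF V(2)[OF _ that]] .
      show "\<forall>\<^sub>F s in at s0 within {0..1}. \<forall>t\<in>{0..T}. norm (V s t - V s0 t) < e"
        if "s0 \<in> {0..1}" "0 < e" for s0 e
        by (rule variational_solution_equicontinuous[of _ _ "\<lambda>t s. V s t"]) (use that V in auto)
    qed
    show "(X t has_vector_derivative V s t) (at s within {0..1})" if "t \<in> {0..T}" "s \<in> {0..1}" for t s
      by (rule X_differentiable_in_parameter) (use that V in auto)
  qed (use V in auto)
qed

end

section \<open>Derivatives in space-time\<close>

lemma Ck_on_2_imp_Ck_on_1: "Ck_on 2 S f \<Longrightarrow> Ck_on 1 S f"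
  by (auto simp: numeral_2_eq_2 differentiable_imp_continuous_on)

text \<open>On a set where derivatives need not be unique, the derivative chosen by
  \<open>frechet_derivative\<close> is the one whose directional values are assumed continuous, so \<open>F\<close> has to
  be built from that choice.\<close>

lemma Ck_on_1_derivative:
  fixes f :: "'a::euclidean_space \<Rightarrow> 'b::real_normed_vector"
  assumes "Ck_on 1 S f"
  obtains F :: "'a \<Rightarrow> 'a \<Rightarrow>\<^sub>L 'b" where
    "\<And>x. x \<in> S \<Longrightarrow> (f has_derivative F x) (at x within S)" "continuous_on S F"
proof -
  have diff: "f differentiable_on S"
    and cont: "\<And>i. i \<in> Basis \<Longrightarrow> continuous_on S (\<lambda>x. frechet_derivative f (at x within S) i)"
    using assms by auto
  define F where "F x = Blinfun (frechet_derivative f (at x within S))" for x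
  have der: "(f has_derivative frechet_derivative f (at x within S)) (at x within S)" if "x \<in> S" for x
    using diff that unfolding differentiable_on_def by (simp add: frechet_derivative_works)
  have F: "blinfun_apply (F x) = frechet_derivative f (at x within S)" if "x \<in> S" for x
    using has_derivative_bounded_linear[OF der[OF that]] by (simp add: F_def bounded_linear_Blinfun_apply)
  show thesis
  proof (rule that)
    show "(f has_derivative F x) (at x within S)" if "x \<in> S" for x
      using der[OF that] F[OF that] by simp
    show "continuous_on S F"
    proof (rule continuous_on_blinfun_componentwise)
      show "continuous_on S (\<lambda>x. F x i)" if "i \<in> Basis" for i
        using cont[OF that] by (rule continuous_on_eq) (simp add: F)
    qed
  qed
qed

lemma spacetime_derivative_along_motion:
  assumes f: "((\<lambda>(t, x). f t x) has_derivative F) (at (t, y t) within {0..T} \<times> D)"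
    and y: "(y has_vector_derivative v) (at t within {0..T})" "\<And>s. s \<in> {0..T} \<Longrightarrow> y s \<in> D"
  shows "((\<lambda>s. f s (y s)) has_vector_derivative F (1, v)) (at t within {0..T})"
proof -
  have "((\<lambda>s. (s, y s)) has_derivative (\<lambda>h. (h, h *\<^sub>R v))) (at t within {0..T})"
    using y(1) unfolding has_vector_derivative_def by (intro derivative_intros)
  then have "(((\<lambda>(t, x). f t x) \<circ> (\<lambda>s. (s, y s))) has_derivative (F \<circ> (\<lambda>h. (h, h *\<^sub>R v)))) (at t within {0..T})"
    by (rule diff_chain_within) (rule has_derivative_subset[OF f], use y(2) in auto)
  moreover have "F (h, h *\<^sub>R v) = h *\<^sub>R F (1, v)" for h
    using linear_scale[OF has_derivative_linear[OF f], of h "(1, v)"] by simp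
  ultimately show ?thesis by (simp add: has_vector_derivative_def o_def)
qed

text \<open>The space-time derivative is taken within \<open>{0..T} \<times> D\<close>. As \<open>D\<close> is open, its spatial part is an
  unrestricted derivative even at the end points of the time interval, as the differential
  operators \<open>partial\<close>, \<open>grad\<close> and \<open>advect\<close> demand.\<close>

lemma spatial_derivative_from_spacetime:
  assumes f: "((\<lambda>(t, x). f t x) has_derivative F) (at (t, x) within {0..T} \<times> D)"
    and "open D" "x \<in> D" "t \<in> {0..T}"
  shows "(f t has_derivative (\<lambda>h. F (0, h))) (at x)"
proof -
  have "((\<lambda>y. (t, y)) has_derivative (\<lambda>h. (0, h))) (at x within D)"
    by (intro derivative_intros)
  then have "(((\<lambda>(t, x). f t x) \<circ> (\<lambda>y. (t, y))) has_derivative (F \<circ> (\<lambda>h. (0, h)))) (at x within D)"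
    by (rule diff_chain_within) (rule has_derivative_subset[OF f], use assms in auto)
  then show ?thesis
    using at_within_open[OF \<open>x \<in> D\<close> \<open>open D\<close>] by (simp add: o_def)
qed

section \<open>Rate of change of a circulation\<close>

context transported_curve
begin

text \<open>The curve is pulled back to the fixed parameter interval, where the integrand is
  \<open>F t (X t s) \<bullet> W t s\<close>. Differentiation under the integral sign gives two contributions: the
  material derivative of \<open>F\<close>, and the stretching of the tangent, \<open>\<partial>\<^sub>t W = Du W\<close>.\<close>

lemma circulation_has_derivative:
  fixes F :: "real \<Rightarrow> 'a \<Rightarrow> 'a" and dF :: "real \<times> 'a \<Rightarrow> (real \<times> 'a) \<Rightarrow>\<^sub>L 'a"
  assumes F: "\<And>p. p \<in> {0..T} \<times> D \<Longrightarrow> ((\<lambda>(t, x). F t x) has_derivative blinfun_apply (dF p)) (at p within {0..T} \<times> D)"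
    and dF_cont: "continuous_on ({0..T} \<times> D) dF"
    and u_cont: "continuous_on ({0..T} \<times> D) (\<lambda>(t, x). u t x)"
    and X_cont: "continuous_on ({0..T} \<times> {0..1}) (\<lambda>(t, s). X t s)"
    and W_cont: "continuous_on ({0..T} \<times> {0..1}) (\<lambda>(t, s). W t s)"
    and XW: "\<And>t s. t \<in> {0..T} \<Longrightarrow> s \<in> {0..1} \<Longrightarrow> (X t has_vector_derivative W t s) (at s within {0..1})"
    and W: "\<And>t s. t \<in> {0..T} \<Longrightarrow> s \<in> {0..1} \<Longrightarrow>
      ((\<lambda>t. W t s) has_vector_derivative Du t (X t s) (W t s)) (at t within {0..T})"
    and t: "t \<in> {0..T}"
  shows "((\<lambda>\<tau>. line_integral (F \<tau>) (X \<tau>)) has_real_derivative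
      integral {0..1} (\<lambda>s. dF (t, X t s) (1, u t (X t s)) \<bullet> W t s + F t (X t s) \<bullet> Du t (X t s) (W t s)))
    (at t within {0..T})"
proof -
  let ?Q = "{0..T} \<times> {0..1::real}" and ?S = "{0..T} \<times> D"
  have pts: "continuous_on ?Q (\<lambda>p. (fst p, X (fst p) (snd p)))"
    using X_cont by (intro continuous_intros) (simp add: case_prod_unfold)
  have pts_in: "(\<lambda>p. (fst p, X (fst p) (snd p))) ` ?Q \<subseteq> ?S"
    using X_in by auto
  have F_cont: "continuous_on ?S (\<lambda>(t, x). F t x)"
    by (rule has_derivative_continuous_on) (rule F)
  have cF: "continuous_on ?Q (\<lambda>p. F (fst p) (X (fst p) (snd p)))"
    using continuous_on_compose2[OF F_cont pts pts_in] by (simp add: case_prod_unfold)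
  have cu: "continuous_on ?Q (\<lambda>p. u (fst p) (X (fst p) (snd p)))"
    using continuous_on_compose2[OF u_cont pts pts_in] by (simp add: case_prod_unfold)
  have cDu: "continuous_on ?Q (\<lambda>p. Du (fst p) (X (fst p) (snd p)))"
    using continuous_on_compose2[OF Du_cont pts pts_in] by (simp add: case_prod_unfold)
  have cdF: "continuous_on ?Q (\<lambda>p. dF (fst p, X (fst p) (snd p)))"
    using continuous_on_compose2[OF dF_cont pts pts_in] by simp
  have cW: "continuous_on ?Q (\<lambda>p. W (fst p) (snd p))"
    using W_cont by (simp add: case_prod_unfold)
  let ?f = "\<lambda>t s. F t (X t s) \<bullet> W t s"
  let ?f' = "\<lambda>t s. dF (t, X t s) (1, u t (X t s)) \<bullet> W t s + F t (X t s) \<bullet> Du t (X t s) (W t s)"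
  have "((\<lambda>\<tau>. integral (cbox 0 1) (?f \<tau>)) has_vector_derivative integral (cbox 0 1) (?f' t)) (at t within {0..T})"
  proof (rule leibniz_rule_vector_derivative[OF _ _ _ t])
    fix \<tau> s assume \<tau>: "\<tau> \<in> {0..T}" and "s \<in> cbox 0 (1::real)"
    then have s: "s \<in> {0..1}" by simp
    have "((\<lambda>\<tau>. F \<tau> (X \<tau> s)) has_vector_derivative dF (\<tau>, X \<tau> s) (1, u \<tau> (X \<tau> s))) (at \<tau> within {0..T})"
      using \<tau> s X_in by (intro spacetime_derivative_along_motion[where D = D] F X_ode) auto
    from bounded_bilinear.has_vector_derivative[OF bounded_bilinear_inner this W[OF \<tau> s]]
    show "((\<lambda>\<tau>. ?f \<tau> s) has_vector_derivative ?f' \<tau> s) (at \<tau> within {0..T})"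
      by (simp add: add.commute)
  next
    fix \<tau> assume \<tau>: "\<tau> \<in> {0..T}"
    have "continuous_on ?Q (\<lambda>p. ?f (fst p) (snd p))" by (intro continuous_intros cF cW)
    then have "continuous_on {0..1} (\<lambda>s. ?f (fst (\<tau>, s)) (snd (\<tau>, s)))"
      by (rule continuous_on_compose2) (use \<tau> in \<open>auto intro!: continuous_intros\<close>)
    then show "?f \<tau> integrable_on cbox 0 1"
      by (simp add: integrable_continuous_real)
  next
    have "continuous_on ?Q (\<lambda>p. ?f' (fst p) (snd p))"
      by (intro continuous_intros cF cW cdF cDu cu)
    then show "continuous_on ({0..T} \<times> cbox 0 1) (\<lambda>(\<tau>, s). ?f' \<tau> s)"
      by (simp add: case_prod_unfold)
  qed simp
  then have "((\<lambda>\<tau>. integral {0..1} (?f \<tau>)) has_real_derivative integral {0..1} (?f' t)) (at t within {0..T})"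
    by (simp add: has_real_derivative_iff_has_vector_derivative)
  then show ?thesis
  proof (rule has_field_derivative_transform_within[OF _ zero_less_one t])
    fix \<tau> assume "\<tau> \<in> {0..T}"
    then show "integral {0..1} (?f \<tau>) = line_integral (F \<tau>) (X \<tau>)"
      unfolding line_integral_def
      by (intro integral_cong)
         (simp add: vector_derivative_within_closed_interval[OF zero_less_one _ XW])
  qed
qed

end

section \<open>Kelvin's theorem for the atmospheric model\<close>

text \<open>The curl is the antisymmetric part of the derivative. For the velocity \<open>v\<close> and
  the tangent \<open>w\<close> of a material curve, \<open>DR v \<bullet> w\<close> is the advection of \<open>R\<close> paired with the tangent,
  while \<open>DR w \<bullet> v\<close> is one of the two terms in the derivative of \<open>R \<bullet> v\<close> along the curve. Hence the
  Coriolis force cancels the advection of \<open>R\<close> up to an exact derivative.\<close>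

lemma coriolis_inner:
  assumes R: "(R has_derivative R') (at x)"
  shows "coriolis R x v \<bullet> w = R' v \<bullet> w - R' w \<bullet> v"
proof -
  have comp: "partial a (\<lambda>y. R y $ i) x = R' a $ i" for a i
  proof -
    have "((\<lambda>y. R y $ i) has_derivative (\<lambda>h. R' h $ i)) (at x)"
      by (rule bounded_linear.has_derivative[OF bounded_linear_vec_nth R])
    then show ?thesis unfolding partial_def by (simp add: frechet_derivative_at[symmetric])
  qed
  have lin: "R' h = h $ 1 *\<^sub>R R' (axis 1 1) + h $ 2 *\<^sub>R R' (axis 2 1)" for h :: "real^2"
  proof -
    have "h = h $ 1 *\<^sub>R axis 1 1 + h $ 2 *\<^sub>R axis 2 1"
      by (simp add: vec_eq_iff forall_2 axis_def)
    then have "R' h = R' (h $ 1 *\<^sub>R axis 1 1 + h $ 2 *\<^sub>R axis 2 1)" by simp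
    also have "\<dots> = h $ 1 *\<^sub>R R' (axis 1 1) + h $ 2 *\<^sub>R R' (axis 2 1)"
      using has_derivative_linear[OF R] by (simp add: linear_add linear_scale)
    finally show ?thesis .
  qed
  show ?thesis
    unfolding coriolis_def curl_def comp lin[of v] lin[of w]
    by (simp add: zhat_def embed3_def planar_part_def cross3_def inner_vec_def sum_2
        axis_def vector_2 vector_3 algebra_simps)
qed

lemma derivative_eq_sum_partials:
  fixes f :: "'a::euclidean_space \<Rightarrow> 'b::real_normed_vector"
  assumes f: "(f has_derivative f') (at x)"
  shows "f' v = (\<Sum>i\<in>Basis. (v \<bullet> i) *\<^sub>R partial i f x)"
proof -
  have "f' v = f' (\<Sum>i\<in>Basis. (v \<bullet> i) *\<^sub>R i)" by (simp add: euclidean_representation)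
  also have "\<dots> = (\<Sum>i\<in>Basis. (v \<bullet> i) *\<^sub>R f' i)"
    using has_derivative_linear[OF f] by (simp add: linear_sum linear_scale)
  finally show ?thesis by (simp add: partial_def frechet_derivative_at[OF f, symmetric])
qed

lemma advect_eq_derivative: "(f has_derivative f') (at x) \<Longrightarrow> advect v f x = f' v"
  by (simp add: advect_def derivative_eq_sum_partials)

lemma grad_inner: "(f has_derivative f') (at x) \<Longrightarrow> grad f x \<bullet> w = f' w"
  by (simp add: grad_def derivative_eq_sum_partials inner_sum_left inner_commute[of w] mult.commute)

theorem theorem1p1:
  fixes D :: "(real^2) set" and T Roa Rea Pea \<gamma> :: real
    and R :: "real^2 \<Rightarrow> real^2" and \<Omega> :: "real^2 \<Rightarrow> real"
    and ua uo :: "real \<Rightarrow> real^2 \<Rightarrow> real^2" and \<theta>a \<theta>o :: "real \<Rightarrow> real^2 \<Rightarrow> real"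
    and g :: "real \<Rightarrow> real^2 \<Rightarrow> real^2" and c :: "real \<Rightarrow> real^2"
  assumes "open D" and "connected D" and "T > 0"
    and "Roa > 0" and "Rea > 0" and "Pea > 0" and "\<gamma> < 0"
    and "smooth_on D R"
    and "\<forall>x\<in>D. curl R x = (2 * \<Omega> x) *\<^sub>R zhat"
    and "Ck_on 2 ({0..T} \<times> D) (\<lambda>(t, x). ua t x)"
    and "Ck_on 2 ({0..T} \<times> D) (\<lambda>(t, x). \<theta>a t x)"
    and "Ck_on 2 ({0..T} \<times> D) (\<lambda>(t, x). uo t x)"
    and "Ck_on 2 ({0..T} \<times> D) (\<lambda>(t, x). \<theta>o t x)"
    and "atmosphere_momentum T D Roa Rea R ua \<theta>a"
    and "atmosphere_temperature T D Pea \<gamma> ua \<theta>a \<theta>o"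
    and "smooth_on {0..1} c" and "pathfinish c = pathstart c" and "path_image c \<subseteq> D"
    and "flow_on T D ua (path_image c) g"
  shows "\<forall>t\<in>{0..T}.
    ((\<lambda>\<tau>. line_integral (\<lambda>x. ua \<tau> x + (1 / Roa) *\<^sub>R R x) (g \<tau> \<circ> c)) has_real_derivative
      (1 / Rea) * line_integral (laplacian (ua t)) (g t \<circ> c)) (at t within {0..T})"
proof
  fix t assume t: "t \<in> {0..T}"
  let ?S = "{0..T} \<times> D"
  obtain U where U: "\<And>p. p \<in> ?S \<Longrightarrow> ((\<lambda>(t, x). ua t x) has_derivative blinfun_apply (U p)) (at p within ?S)"
    and U_cont: "continuous_on ?S U"
    using Ck_on_1_derivative[OF Ck_on_2_imp_Ck_on_1[OF assms(10)]] by blast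
  obtain \<Theta> where \<Theta>: "\<And>p. p \<in> ?S \<Longrightarrow> ((\<lambda>(t, x). \<theta>a t x) has_derivative blinfun_apply (\<Theta> p)) (at p within ?S)"
    using Ck_on_1_derivative[OF Ck_on_2_imp_Ck_on_1[OF assms(11)]] by blast
  have "Ck_on 1 D R" "Ck_on 1 {0..1} c"
    using assms(8,16) by (auto simp only: smooth_on_def)
  obtain DR where DR_within: "\<And>x. x \<in> D \<Longrightarrow> (R has_derivative blinfun_apply (DR x)) (at x within D)"
    and DR_cont: "continuous_on D DR"
    using Ck_on_1_derivative[OF \<open>Ck_on 1 D R\<close>] by blast
  have DR: "(R has_derivative DR x) (at x)" if "x \<in> D" for x
    using DR_within[OF that] at_within_open[OF that \<open>open D\<close>] by simp
  obtain dc where dc: "\<And>s. s \<in> {0..1} \<Longrightarrow> (c has_derivative blinfun_apply (dc s)) (at s within {0..1})"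
    and dc_cont: "continuous_on {0..1} dc"
    using Ck_on_1_derivative[OF \<open>Ck_on 1 {0..1} c\<close>] by blast
  define Du where "Du t x = U (t, x) o\<^sub>L Blinfun (\<lambda>h. (0, h))" for t x
  have Du: "Du t x h = U (t, x) (0, h)" for t x h
    by (simp add: Du_def bounded_linear_Blinfun_apply bounded_linear_Pair bounded_linear_zero bounded_linear_ident)
  define X where "X t s = g t (c s)" for t s
  have X_comp: "g \<tau> \<circ> c = X \<tau>" for \<tau> by (simp add: X_def fun_eq_iff)
  have c_in: "c s \<in> path_image c" if "s \<in> {0..1}" for s
    using that by (simp add: path_image_def)
  have flow: "g 0 x = x" "\<And>t. t \<in> {0..T} \<Longrightarrow> g t x \<in> D"
    "\<And>t. t \<in> {0..T} \<Longrightarrow> ((\<lambda>s. g s x) has_vector_derivative ua t (g t x)) (at t within {0..T})"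
    if "x \<in> path_image c" for x
    using assms(19) that unfolding flow_on_def by blast+
  have u_deriv: "(ua t has_derivative Du t x) (at x)" if "t \<in> {0..T}" "x \<in> D" for t x
    using spatial_derivative_from_spacetime[OF U \<open>open D\<close>, of t x] that
    by (simp add: Du[abs_def])
  have \<theta>_deriv: "(\<theta>a t has_derivative (\<lambda>h. \<Theta> (t, x) (0, h))) (at x)" if "t \<in> {0..T}" "x \<in> D" for t x
    using spatial_derivative_from_spacetime[OF \<Theta> \<open>open D\<close>, of t x] that by simp
  interpret transported_curve T D ua Du X "\<lambda>s. dc s 1"
  proof
    show "continuous_on ?S (\<lambda>(t, x). Du t x)"
      unfolding Du_def case_prod_unfold
      by (intro bounded_bilinear.continuous_on[OF bounded_bilinear_blinfun_compose] continuous_intros)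
         (use U_cont in simp)
    show "X t s \<in> D" if "t \<in> {0..T}" "s \<in> {0..1}" for t s
      unfolding X_def using flow(2) c_in that by blast
    show "((\<lambda>t. X t s) has_vector_derivative ua t (X t s)) (at t within {0..T})"
      if "t \<in> {0..T}" "s \<in> {0..1}" for t s
      unfolding X_def using flow(3) c_in that by blast
    show "(X 0 has_vector_derivative dc s 1) (at s within {0..1})" if s: "s \<in> {0..1}" for s
    proof (rule has_vector_derivative_transform[OF s])
      show "X 0 r = c r" if "r \<in> {0..1}" for r
        unfolding X_def using flow(1) c_in that by blast
      have eq: "(\<lambda>h. h *\<^sub>R dc s 1) = blinfun_apply (dc s)"
        by (simp add: fun_eq_iff flip: blinfun.scaleR_right)
      show "(c has_vector_derivative dc s 1) (at s within {0..1})"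
        using dc[OF s] unfolding has_vector_derivative_def eq .
    qed
    show "continuous_on {0..1} (\<lambda>s. dc s 1)"
      by (intro continuous_intros dc_cont)
  qed (use \<open>T > 0\<close> \<open>open D\<close> u_deriv in auto)
  obtain W where W:
    "continuous_on ({0..T} \<times> {0..1}) (\<lambda>(t, s). X t s)"
    "continuous_on ({0..T} \<times> {0..1}) (\<lambda>(t, s). W t s)"
    "\<And>t s. t \<in> {0..T} \<Longrightarrow> s \<in> {0..1} \<Longrightarrow> (X t has_vector_derivative W t s) (at s within {0..1})"
    "\<And>t s. t \<in> {0..T} \<Longrightarrow> s \<in> {0..1} \<Longrightarrow>
      ((\<lambda>t. W t s) has_vector_derivative Du t (X t s) (W t s)) (at t within {0..T})"
    using differentiable_dependence by metis
  define F where "F \<tau> x = ua \<tau> x + (1 / Roa) *\<^sub>R R x" for \<tau> x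
  define dF where "dF p = U p + (1 / Roa) *\<^sub>R (DR (snd p) o\<^sub>L Blinfun snd)" for p :: "real \<times> (real^2)"
  have dF_apply: "dF p h = U p h + (1 / Roa) *\<^sub>R DR (snd p) (snd h)" for p h
    by (simp add: dF_def blinfun.add_left blinfun.scaleR_left bounded_linear_Blinfun_apply bounded_linear_snd)
  let ?\<Phi> = "\<lambda>s. dF (t, X t s) (1, ua t (X t s)) \<bullet> W t s + F t (X t s) \<bullet> Du t (X t s) (W t s)"
  have derivative: "((\<lambda>\<tau>. line_integral (F \<tau>) (X \<tau>)) has_real_derivative integral {0..1} ?\<Phi>) (at t within {0..T})"
  proof (rule circulation_has_derivative[OF _ _ _ W t])
    show "((\<lambda>(t, x). F t x) has_derivative blinfun_apply (dF p)) (at p within ?S)" if p: "p \<in> ?S" for p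
    proof -
      have "(R \<circ> snd has_derivative (DR (snd p) \<circ> snd)) (at p within ?S)"
        by (rule diff_chain_within, rule derivative_intros)
           (use p DR_within in \<open>auto intro: has_derivative_subset\<close>)
      then have "((\<lambda>p. (case p of (t, x) \<Rightarrow> ua t x) + (1 / Roa) *\<^sub>R R (snd p)) has_derivative
          (\<lambda>h. U p h + (1 / Roa) *\<^sub>R DR (snd p) (snd h))) (at p within ?S)"
        by (intro derivative_intros U p) (simp add: o_def)
      then show ?thesis by (simp add: F_def case_prod_unfold dF_apply[abs_def])
    qed
    show "continuous_on ?S dF"
      unfolding dF_def
      by (intro continuous_intros U_cont bounded_bilinear.continuous_on[OF bounded_bilinear_blinfun_compose]
          continuous_on_compose2[OF DR_cont]) auto
    show "continuous_on ?S (\<lambda>(t, x). ua t x)"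
      by (rule has_derivative_continuous_on) (rule U)
  qed
  let ?V = "\<lambda>s. ua t (X t s)"
  \<comment> \<open>\<open>P\<close> is the potential whose increment around the closed loop vanishes: kinetic energy, the pairing of \<open>R\<close> with the velocity, and the temperature as pressure.\<close>
  define P where "P s = ?V s \<bullet> ?V s / 2 + (R (X t s) \<bullet> ?V s - \<theta>a t (X t s)) / Roa" for s
  define P' where "P' s = ?V s \<bullet> Du t (X t s) (W t s) +
    (DR (X t s) (W t s) \<bullet> ?V s + R (X t s) \<bullet> Du t (X t s) (W t s) - \<Theta> (t, X t s) (0, W t s)) / Roa" for s
  have "(P' has_integral (P 1 - P 0)) {0..1}"
  proof (rule fundamental_theorem_of_calculus)
    fix s :: real assume s: "s \<in> {0..1}"
    note x = X_in[OF t s] and dX = W(3)[OF t s]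
    have chain: "((\<lambda>s. f (X t s)) has_vector_derivative f' (W t s)) (at s within {0..1})"
      if "(f has_derivative f') (at (X t s))" for f :: "real^2 \<Rightarrow> 'b::real_normed_vector" and f'
      using vector_derivative_diff_chain_within[OF dX has_derivative_at_withinI[OF that]]
      by (simp add: o_def)
    note dV = chain[OF u_deriv[OF t x]] and dR = chain[OF DR[OF x]] and d\<theta> = chain[OF \<theta>_deriv[OF t x]]
    have "(P has_vector_derivative
        (?V s \<bullet> Du t (X t s) (W t s) + Du t (X t s) (W t s) \<bullet> ?V s) / 2 +
        ((R (X t s) \<bullet> Du t (X t s) (W t s) + DR (X t s) (W t s) \<bullet> ?V s) - \<Theta> (t, X t s) (0, W t s)) / Roa)
        (at s within {0..1})"
      unfolding P_def
      by (intro has_vector_derivative_add has_vector_derivative_diff has_vector_derivative_divide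
          bounded_bilinear.has_vector_derivative[OF bounded_bilinear_inner] dV dR d\<theta>)
    then show "(P has_vector_derivative P' s) (at s within {0..1})"
      by (simp add: P'_def inner_commute add.commute)
  qed simp
  moreover have "P 1 = P 0"
    using assms(17) by (simp add: P_def X_def pathfinish_def pathstart_def)
  ultimately have P'_int: "(P' has_integral 0) {0..1}" by simp
  \<comment> \<open>Inserting the momentum equation, the integrand is the viscous term plus the exact derivative \<open>P'\<close>.\<close>
  have pointwise: "?\<Phi> s - P' s = (1 / Rea) * (laplacian (ua t) (X t s) \<bullet> W t s)" if s: "s \<in> {0..1}" for s
  proof -
    let ?x = "X t s" and ?w = "W t s"
    have x: "?x \<in> D" by (rule X_in[OF t s])
    \<comment> \<open>The material derivative splits into its local and its advective part.\<close>
    have split: "U (t, ?x) (1, v) = U (t, ?x) (1, 0) + Du t ?x v" for v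
      by (simp add: Du flip: blinfun.add_right)
    have "((\<lambda>\<tau>. ua \<tau> ?x) has_vector_derivative U (t, ?x) (1, 0)) (at t within {0..T})"
      using t x by (intro spacetime_derivative_along_motion[where D = D and f = ua and y = "\<lambda>_. ?x"] U) auto
    then have dt: "vector_derivative (\<lambda>\<tau>. ua \<tau> ?x) (at t within {0..T}) = U (t, ?x) (1, 0)"
      using vector_derivative_within_closed_interval[OF \<open>T > 0\<close> t] by blast
    have "U (t, ?x) (1, 0) + Du t ?x (?V s) + (1 / Roa) *\<^sub>R coriolis R ?x (?V s) + (1 / Roa) *\<^sub>R grad (\<theta>a t) ?x
        = (1 / Rea) *\<^sub>R laplacian (ua t) ?x"
      using assms(14) t x unfolding atmosphere_momentum_def
      by (metis dt advect_eq_derivative[OF u_deriv[OF t x]])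
    then have "(U (t, ?x) (1, 0) + Du t ?x (?V s) + (1 / Roa) *\<^sub>R coriolis R ?x (?V s) + (1 / Roa) *\<^sub>R grad (\<theta>a t) ?x) \<bullet> ?w
        = (1 / Rea) * (laplacian (ua t) ?x \<bullet> ?w)"
      by simp
    then have "(U (t, ?x) (1, 0) + Du t ?x (?V s)) \<bullet> ?w +
        (DR ?x (?V s) \<bullet> ?w - DR ?x ?w \<bullet> ?V s + \<Theta> (t, ?x) (0, ?w)) / Roa
        = (1 / Rea) * (laplacian (ua t) ?x \<bullet> ?w)"
      by (simp add: inner_add_left coriolis_inner[OF DR[OF x]] grad_inner[OF \<theta>_deriv[OF t x]] add_divide_distrib diff_divide_distrib)
    moreover have "?\<Phi> s - P' s = (U (t, ?x) (1, 0) + Du t ?x (?V s)) \<bullet> ?w +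
        (DR ?x (?V s) \<bullet> ?w - DR ?x ?w \<bullet> ?V s + \<Theta> (t, ?x) (0, ?w)) / Roa"
      by (simp add: P'_def F_def dF_apply split[of "?V s"] inner_add_left add_divide_distrib diff_divide_distrib)
    ultimately show ?thesis by simp
  qed
  have "integral {0..1} ?\<Phi> = (1 / Rea) * line_integral (laplacian (ua t)) (X t)"
  proof -
    have "integral {0..1} ?\<Phi> = integral {0..1} (\<lambda>s. ?\<Phi> s - P' s)"
    \<comment> \<open>A non-integrable function has integral zero by convention, and adding the integrable \<open>P'\<close> does not change integrability; this spares showing that \<open>?\<Phi>\<close> is integrable.\<close>
    proof (cases "?\<Phi> integrable_on {0..1}")
      case True
      then show ?thesis using P'_int by (simp add: integral_diff has_integral_iff)
    next
      case False
      moreover have "\<not> (\<lambda>s. ?\<Phi> s - P' s) integrable_on {0..1}"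
        using False integrable_add[of "\<lambda>s. ?\<Phi> s - P' s" "{0..1}" P'] P'_int by (auto simp: has_integral_iff)
      ultimately show ?thesis by (simp add: not_integrable_integral)
    qed
    also have "\<dots> = integral {0..1} (\<lambda>s. (1 / Rea) * (laplacian (ua t) (X t s) \<bullet> W t s))"
      by (intro integral_cong pointwise)
    also have "\<dots> = (1 / Rea) * integral {0..1} (\<lambda>s. laplacian (ua t) (X t s) \<bullet> W t s)"
      by (rule integral_mult_right)
    also have "integral {0..1} (\<lambda>s. laplacian (ua t) (X t s) \<bullet> W t s) = line_integral (laplacian (ua t)) (X t)"
      unfolding line_integral_def
      by (intro integral_cong)
         (simp add: vector_derivative_within_closed_interval[OF zero_less_one _ W(3)[OF t]])
    finally show ?thesis .
  qed
  then show "((\<lambda>\<tau>. line_integral (\<lambda>x. ua \<tau> x + (1 / Roa) *\<^sub>R R x) (g \<tau> \<circ> c)) has_real_derivative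
      (1 / Rea) * line_integral (laplacian (ua t)) (g t \<circ> c)) (at t within {0..T})"
    using derivative by (simp add: X_comp F_def[abs_def])
qed

end
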